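(* Let $X$ be a nonempty set, let $D=(d_i;\, i\ge 0)$ be a sufficient denumerable family of semimetrics on $X$, and assume that $(X,D)$ is complete. Let $\Phi=(\varphi_i;\, i\ge 0)$ be a sequence of (finite-valued) functions $\varphi_i:X\to\mathbb{R}$ such that: - for some $j\in\{3,4\}$, all $\varphi_i$ ($i\ge 0$) belong to the subclass (P$j$); - for some $k\in\{2,3\}$, all $\varphi_i$ ($i\ge 0$) belong to the subclass (L$k$). Then, for each $u\in X$ there exists $v=v(u)\in X$ such that $$d_i(u,v)\le\varphi_i(u)-\varphi_i(v)\quad\text{for all } i\ge 0,$$ and, for every $x\in X\setminus\{v\}$, there exists an index $i=i(x)\ge 0$ with $$d_i(v,x)>\varphi_i(v)-\varphi_i(x).$$
   Context: A semimetric on $X$ is a map $d:X\times X\to[0,\infty)$ that is symmetric, satisfies the triangle inequality, and has $d(x,x)=0$ for all $x$. The family $D=(d_i;\,i\ge0)$ is sufficient if $d_i(x,y)=0$ for all $i\ge 0$ implies $x=y$. A sequence $(x_n)$ in $X$ $D$-converges to $x$ (written $x_n\to_D x$) if $d_i(x_n,x)\to0$ as $n\to\infty$ for each $i\ge0$; it is $D$-Cauchy if $d_i(x_m,x_n)\to0$ as $m,n\to\infty$ for each $i\ge 0$. $(X,D)$ is complete if every $D$-Cauchy sequence is $D$-convergent. Subclasses of functions $\varphi$ on $X$: (P3) $\inf\varphi(X)>-\infty$; (P4) $\inf\varphi(X)\ge0$; (L2) (descending $D$-lsc) if $x_n\to_D x$ and $(\varphi(x_n))$ is descending, then $\varphi(x_n)\ge\varphi(x)$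 for all $n$; (L3) ($D$-lsc) if $x_n\to_D x$, then $\liminf_n\varphi(x_n)\ge\varphi(x)$. The result is understood in Zermelo-Fraenkel set theory without the Axiom of Choice, augmented by the Principle of Dependent Choices. *)

theory Defs
  imports "HOL-Analysis.Analysis"
begin

text \<open>Semimetrics and functions live on an explicit carrier \<open>X\<close>; their values outside \<open>X\<close>
  are irrelevant. Zero distance between distinct points is allowed.\<close>

definition semimetric_on :: "'a set \<Rightarrow> ('a \<Rightarrow> 'a \<Rightarrow> real) \<Rightarrow> bool" where
  "semimetric_on X d \<longleftrightarrow>
     (\<forall>x\<in>X. \<forall>y\<in>X. 0 \<le> d x y) \<and>
     (\<forall>x\<in>X. \<forall>y\<in>X. d x y = d y x) \<and>
     (\<forall>x\<in>X. \<forall>y\<in>X. \<forall>z\<in>X. d x z \<le> d x y + d y z) \<and>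
     (\<forall>x\<in>X. d x x = 0)"

definition sufficient_family :: "'a set \<Rightarrow> (nat \<Rightarrow> 'a \<Rightarrow> 'a \<Rightarrow> real) \<Rightarrow> bool" where
  "sufficient_family X D \<longleftrightarrow> (\<forall>x\<in>X. \<forall>y\<in>X. (\<forall>i. D i x y = 0) \<longrightarrow> x = y)"

definition D_converges ::
    "'a set \<Rightarrow> (nat \<Rightarrow> 'a \<Rightarrow> 'a \<Rightarrow> real) \<Rightarrow> (nat \<Rightarrow> 'a) \<Rightarrow> 'a \<Rightarrow> bool" where
  "D_converges X D s x \<longleftrightarrow>
     range s \<subseteq> X \<and> x \<in> X \<and> (\<forall>i. (\<lambda>n. D i (s n) x) \<longlonglongrightarrow> 0)"

definition D_Cauchy :: "'a set \<Rightarrow> (nat \<Rightarrow> 'a \<Rightarrow> 'a \<Rightarrow> real) \<Rightarrow> (nat \<Rightarrow> 'a) \<Rightarrow> bool" where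
  "D_Cauchy X D s \<longleftrightarrow>
     range s \<subseteq> X \<and>
     (\<forall>i. \<forall>e>0. \<exists>N. \<forall>m\<ge>N. \<forall>n\<ge>N. D i (s m) (s n) < e)"

definition D_complete :: "'a set \<Rightarrow> (nat \<Rightarrow> 'a \<Rightarrow> 'a \<Rightarrow> real) \<Rightarrow> bool" where
  "D_complete X D \<longleftrightarrow> (\<forall>s. D_Cauchy X D s \<longrightarrow> (\<exists>x. D_converges X D s x))"

text \<open>Infima and lower limits are taken in \<^typ>\<open>ereal\<close>, so that they exist for every
  real-valued function.\<close>

definition class_P3 :: "'a set \<Rightarrow> ('a \<Rightarrow> real) \<Rightarrow> bool" where
  "class_P3 X \<phi> \<longleftrightarrow> (INF x\<in>X. ereal (\<phi> x)) > - \<infinity>"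

definition class_P4 :: "'a set \<Rightarrow> ('a \<Rightarrow> real) \<Rightarrow> bool" where
  "class_P4 X \<phi> \<longleftrightarrow> (INF x\<in>X. ereal (\<phi> x)) \<ge> 0"

definition class_L2 ::
    "'a set \<Rightarrow> (nat \<Rightarrow> 'a \<Rightarrow> 'a \<Rightarrow> real) \<Rightarrow> ('a \<Rightarrow> real) \<Rightarrow> bool" where
  "class_L2 X D \<phi> \<longleftrightarrow>
     (\<forall>s x. D_converges X D s x \<and> decseq (\<lambda>n. \<phi> (s n)) \<longrightarrow> (\<forall>n. \<phi> (s n) \<ge> \<phi> x))"

definition class_L3 ::
    "'a set \<Rightarrow> (nat \<Rightarrow> 'a \<Rightarrow> 'a \<Rightarrow> real) \<Rightarrow> ('a \<Rightarrow> real) \<Rightarrow> bool" where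
  "class_L3 X D \<phi> \<longleftrightarrow>
     (\<forall>s x. D_converges X D s x \<longrightarrow> liminf (\<lambda>n. ereal (\<phi> (s n))) \<ge> ereal (\<phi> x))"

end

theory Submission
  imports Defs
begin

text \<open>
  Put \<open>x \<preceq> y\<close> if \<open>D i x y \<le> \<Phi> i x - \<Phi> i y\<close> for all \<open>i\<close>. The two claims say that
  \<open>u \<preceq> v\<close> and that \<open>v\<close> is maximal, so the theorem is a maximality principle for this
  quasi-order, and it follows the pattern of Ekeland's variational principle.

  Along a \<open>\<preceq>\<close>-ascending sequence every \<open>\<Phi> i\<close> descends and is bounded below, hence it
  converges, and its increments dominate the distances \<open>D i\<close>. So the sequence is Cauchy in
  every semimetric at once (\<open>ascending_imp_D_Cauchy\<close>), and completeness provides a limit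
  \<open>v\<close>. Descending lower semicontinuity makes this limit an upper bound of the sequence
  (\<open>ascending_limit_upper_bound\<close>).

  Maximality of \<open>v\<close> comes from a greedy choice of the sequence. With a single function,
  each new term would nearly minimize it above the preceding term. Countably many functions
  cannot in general be nearly minimized simultaneously, but it is enough to treat one of them
  at each step, provided that every index has its turn infinitely often
  (\<open>ex_minimizing_ascending\<close>). If \<open>v \<preceq> x\<close>, then \<open>x\<close> competed at every step, so
  \<open>\<Phi> i x \<ge> \<Phi> i v - \<epsilon>\<close> for every \<open>i\<close> and \<open>\<epsilon> > 0\<close>. Hence \<open>D i v x \<le> 0\<close> for all
  \<open>i\<close>, and sufficiency gives \<open>x = v\<close>.

  The only infinite sequence of choices is that of the terms of the greedy sequence, an instance
  of dependent choice.
\<close>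

section \<open>Reduction of the subclasses\<close>

lemma class_P4_imp_class_P3:
  assumes "class_P4 X \<phi>"
  shows "class_P3 X \<phi>"
proof -
  have "- \<infinity> < (0::ereal)" by simp
  also have "0 \<le> (INF x\<in>X. ereal (\<phi> x))"
    using assms by (simp add: class_P4_def)
  finally show ?thesis by (simp add: class_P3_def)
qed

lemma class_P3_imp_bdd_below:
  assumes "class_P3 X \<phi>"
  shows "bdd_below (\<phi> ` X)"
proof -
  obtain c :: real where c: "ereal c < (INF x\<in>X. ereal (\<phi> x))"
    using assms ereal_dense2 unfolding class_P3_def by blast
  have "c \<le> \<phi> x" if "x \<in> X" for x
  proof -
    have "(INF x\<in>X. ereal (\<phi> x)) \<le> ereal (\<phi> x)"
      using that by (rule INF_lower)
    with c have "ereal c < ereal (\<phi> x)" by (rule less_le_trans)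
    then show ?thesis by simp
  qed
  then show ?thesis by (rule bdd_belowI2)
qed

text \<open>Each term of a descending sequence bounds all later terms, hence also their lower limit.\<close>

lemma class_L3_imp_class_L2:
  assumes "class_L3 X D \<phi>"
  shows "class_L2 X D \<phi>"
  unfolding class_L2_def
proof (intro allI impI, elim conjE)
  fix s x n
  assume conv: "D_converges X D s x" and dec: "decseq (\<lambda>n. \<phi> (s n))"
  have "ereal (\<phi> x) \<le> liminf (\<lambda>n. ereal (\<phi> (s n)))"
    using assms conv by (simp add: class_L3_def)
  also have "\<dots> \<le> limsup (\<lambda>n. ereal (\<phi> (s n)))"
    by (simp add: Liminf_le_Limsup)
  also have "\<dots> \<le> ereal (\<phi> (s n))"
    using dec by (intro Limsup_bounded eventually_sequentiallyI[of n]) (simp add: decseq_def)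
  finally show "\<phi> x \<le> \<phi> (s n)" by simp
qed

section \<open>The quasi-order of a family of functions\<close>

definition family_le ::
    "(nat \<Rightarrow> 'a \<Rightarrow> 'a \<Rightarrow> real) \<Rightarrow> (nat \<Rightarrow> 'a \<Rightarrow> real) \<Rightarrow> 'a \<Rightarrow> 'a \<Rightarrow> bool" where
  "family_le D \<Phi> x y \<longleftrightarrow> (\<forall>i. D i x y \<le> \<Phi> i x - \<Phi> i y)"

lemma family_leD: "family_le D \<Phi> x y \<Longrightarrow> D i x y \<le> \<Phi> i x - \<Phi> i y"
  by (simp add: family_le_def)

locale semimetric_family =
  fixes X :: "'a set" and D :: "nat \<Rightarrow> 'a \<Rightarrow> 'a \<Rightarrow> real"
  assumes semimetric: "\<And>i. semimetric_on X (D i)"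
begin

lemma dist_nonneg: "x \<in> X \<Longrightarrow> y \<in> X \<Longrightarrow> 0 \<le> D i x y"
  and dist_sym: "x \<in> X \<Longrightarrow> y \<in> X \<Longrightarrow> D i x y = D i y x"
  and dist_triangle: "x \<in> X \<Longrightarrow> y \<in> X \<Longrightarrow> z \<in> X \<Longrightarrow> D i x z \<le> D i x y + D i y z"
  and dist_self: "x \<in> X \<Longrightarrow> D i x x = 0"
  using semimetric[of i] unfolding semimetric_on_def by blast+

lemma family_le_refl: "x \<in> X \<Longrightarrow> family_le D \<Phi> x x"
  by (simp add: family_le_def dist_self)

lemma family_le_trans:
  assumes "x \<in> X" "y \<in> X" "z \<in> X" and "family_le D \<Phi> x y" "family_le D \<Phi> y z"
  shows "family_le D \<Phi> x z"
  unfolding family_le_def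
proof
  fix i
  show "D i x z \<le> \<Phi> i x - \<Phi> i z"
    using dist_triangle[OF assms(1-3), of i] family_leD[OF assms(4), of i] family_leD[OF assms(5), of i]
    by linarith
qed

lemma family_le_antimono:
  assumes "x \<in> X" "y \<in> X" "family_le D \<Phi> x y"
  shows "\<Phi> i y \<le> \<Phi> i x"
  using dist_nonneg[OF assms(1,2), of i] family_leD[OF assms(3), of i] by linarith

lemma ascending_chain:
  assumes X: "\<And>n. s n \<in> X" and step: "\<And>n. family_le D \<Phi> (s n) (s (Suc n))" and "m \<le> n"
  shows "family_le D \<Phi> (s m) (s n)"
  using \<open>m \<le> n\<close>
proof (induction n rule: dec_induct)
  case base
  show ?case using X by (rule family_le_refl)
next
  case (step n)
  then show ?case using X assms(2) family_le_trans by blast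
qed

section \<open>Ascending sequences and their limits\<close>

lemma ascending_imp_decseq:
  assumes "\<And>n. s n \<in> X" and "\<And>m n. m \<le> n \<Longrightarrow> family_le D \<Phi> (s m) (s n)"
  shows "decseq (\<lambda>n. \<Phi> i (s n))"
  unfolding decseq_def by (intro allI impI) (rule family_le_antimono[OF assms(1,1,2)])

text \<open>The distances along the sequence are at most differences of terms of \<open>\<Phi> i (s n)\<close>, and
  this real sequence is Cauchy because it descends and is bounded below.\<close>

lemma ascending_imp_D_Cauchy:
  assumes X: "\<And>n. s n \<in> X"
    and asc: "\<And>m n. m \<le> n \<Longrightarrow> family_le D \<Phi> (s m) (s n)"
    and bdd: "\<And>i. bdd_below (\<Phi> i ` X)"
  shows "D_Cauchy X D s"
  unfolding D_Cauchy_def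
proof (intro conjI allI impI)
  show "range s \<subseteq> X" using X by blast
next
  fix i and e :: real
  assume "0 < e"
  have dec: "decseq (\<lambda>n. \<Phi> i (s n))"
    using X asc by (rule ascending_imp_decseq)
  obtain c where "\<And>x. x \<in> X \<Longrightarrow> c \<le> \<Phi> i x"
    using bdd[of i] by (auto simp: bdd_below_def)
  with dec X obtain l where "(\<lambda>n. \<Phi> i (s n)) \<longlonglongrightarrow> l"
    by (metis decseq_convergent)
  then have "Cauchy (\<lambda>n. \<Phi> i (s n))"
    by (rule LIMSEQ_imp_Cauchy)
  then obtain N where N: "\<And>m n. m \<ge> N \<Longrightarrow> n \<ge> N \<Longrightarrow> \<bar>\<Phi> i (s m) - \<Phi> i (s n)\<bar> < e"
    using \<open>0 < e\<close> by (metis CauchyD real_norm_def)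
  have le: "D i (s m) (s n) < e" if "m \<ge> N" "n \<ge> N" "m \<le> n" for m n
    using family_leD[OF asc[OF that(3)], of i] N[OF that(1,2)] by linarith
  have "D i (s m) (s n) < e" if "m \<ge> N" "n \<ge> N" for m n
    using le[of m n] le[of n m] that X dist_sym by (metis linear)
  then show "\<exists>N. \<forall>m\<ge>N. \<forall>n\<ge>N. D i (s m) (s n) < e" by blast
qed

text \<open>Since \<open>\<Phi> i\<close> descends along \<open>s\<close>, descending lower semicontinuity gives
  \<open>\<Phi> i v \<le> \<Phi> i (s m)\<close> for all \<open>m\<close>. For \<open>m \<ge> n\<close>, the triangle inequality through \<open>s m\<close>
  then bounds \<open>D i (s n) v\<close> by \<open>\<Phi> i (s n) - \<Phi> i v + D i (s m) v\<close>, whose last term vanishes as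
  \<open>m\<close> grows.\<close>

lemma ascending_limit_upper_bound:
  assumes asc: "\<And>m n. m \<le> n \<Longrightarrow> family_le D \<Phi> (s m) (s n)"
    and conv: "D_converges X D s v"
    and lsc: "\<And>i. class_L2 X D (\<Phi> i)"
  shows "family_le D \<Phi> (s n) v"
  unfolding family_le_def
proof
  fix i
  have X: "s k \<in> X" for k using conv by (auto simp: D_converges_def)
  have v: "v \<in> X" using conv by (simp add: D_converges_def)
  have "decseq (\<lambda>k. \<Phi> i (s k))"
    using X asc by (rule ascending_imp_decseq)
  with conv have below: "\<Phi> i v \<le> \<Phi> i (s k)" for k
    using lsc[of i, unfolded class_L2_def, rule_format] by simp
  have "D i (s n) v \<le> \<Phi> i (s n) - \<Phi> i v + D i (s m) v" if "n \<le> m" for m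
    using dist_triangle[OF X X v, of i n m] family_leD[OF asc[OF that], of i] below[of m]
    by linarith
  then have "\<forall>m\<ge>n. D i (s n) v \<le> \<Phi> i (s n) - \<Phi> i v + D i (s m) v" by blast
  moreover have "(\<lambda>m. \<Phi> i (s n) - \<Phi> i v + D i (s m) v) \<longlonglongrightarrow> \<Phi> i (s n) - \<Phi> i v + 0"
    using conv by (intro tendsto_add tendsto_const) (simp add: D_converges_def)
  ultimately show "D i (s n) v \<le> \<Phi> i (s n) - \<Phi> i v"
    using LIMSEQ_le_const by fastforce
qed

section \<open>The greedy sequence\<close>

text \<open>The map \<open>\<iota>\<close> is the schedule: its value \<open>\<iota> n\<close> is the index whose turn comes at step \<open>n\<close>.
  Each step is possible because the infimum of one bounded-below function over the points above
  \<open>s n\<close> is approached within any positive tolerance. The tolerances tend to \<open>0\<close>, so that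
  infinitely many turns of an index leave no gap for its function.\<close>

lemma ex_minimizing_ascending:
  fixes \<iota> :: "nat \<Rightarrow> nat"
  assumes u: "u \<in> X" and bdd: "\<And>i. bdd_below (\<Phi> i ` X)"
  obtains s where "\<And>n. s n \<in> X" "\<And>n. family_le D \<Phi> u (s n)"
    "\<And>m n. m \<le> n \<Longrightarrow> family_le D \<Phi> (s m) (s n)"
    "\<And>n x. x \<in> X \<Longrightarrow> family_le D \<Phi> (s n) x \<Longrightarrow>
       \<Phi> (\<iota> n) (s (Suc n)) \<le> \<Phi> (\<iota> n) x + 1 / real (Suc n)"
proof -
  define P where "P = (\<lambda>(n::nat) x. x \<in> X \<and> family_le D \<Phi> u x)"
  define Q where "Q = (\<lambda>n x y. family_le D \<Phi> x y \<and>
    (\<forall>z\<in>X. family_le D \<Phi> x z \<longrightarrow> \<Phi> (\<iota> n) y \<le> \<Phi> (\<iota> n) z + 1 / real (Suc n)))"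
  have "\<exists>y. P (Suc n) y \<and> Q n x y" if "P n x" for n x
  proof -
    have x: "x \<in> X" "family_le D \<Phi> u x" using that by (auto simp: P_def)
    let ?S = "{z \<in> X. family_le D \<Phi> x z}"
    let ?m = "INF z\<in>?S. \<Phi> (\<iota> n) z"
    have ne: "?S \<noteq> {}" using x family_le_refl by blast
    have bS: "bdd_below (\<Phi> (\<iota> n) ` ?S)"
      by (rule bdd_below_mono[OF bdd[of "\<iota> n"]]) auto
    have "?m < ?m + 1 / real (Suc n)" by simp
    then obtain y where y: "y \<in> ?S" "\<Phi> (\<iota> n) y < ?m + 1 / real (Suc n)"
      using cINF_less_iff[OF ne bS] by blast
    have "\<Phi> (\<iota> n) y \<le> \<Phi> (\<iota> n) z + 1 / real (Suc n)" if "z \<in> ?S" for z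
      using y(2) cINF_lower[OF bS that] by linarith
    then have "Q n x y" using y(1) by (simp add: Q_def)
    moreover have "P (Suc n) y"
      using family_le_trans[OF u x(1) _ x(2)] y(1) by (simp add: P_def)
    ultimately show ?thesis by blast
  qed
  moreover have "P 0 u" using u by (simp add: P_def family_le_refl)
  ultimately obtain s where s: "\<And>n. P n (s n) \<and> Q n (s n) (s (Suc n))"
    using dependent_nat_choice[of P Q] by blast
  have X: "s n \<in> X" for n using s by (simp add: P_def)
  have step: "family_le D \<Phi> (s n) (s (Suc n))" for n using s by (simp add: Q_def)
  show ?thesis
  proof
    show "family_le D \<Phi> u (s n)" for n using s by (simp add: P_def)
    show "\<Phi> (\<iota> n) (s (Suc n)) \<le> \<Phi> (\<iota> n) x + 1 / real (Suc n)"
      if "x \<in> X" "family_le D \<Phi> (s n) x" for n x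
      using s[of n] that unfolding Q_def by blast
  qed (use X ascending_chain[where s = s and \<Phi> = \<Phi>, OF X step] in auto)
qed

end

text \<open>Via the pairing function, \<open>n\<close> codes a pair whose first component is the index scheduled at
  \<open>n\<close>; its second component can be any \<open>k\<close>, so that the turns of an index never end.\<close>

lemma schedule_infinitely_often:
  "\<exists>n\<ge>k. fst (prod_decode n) = i"
  by (rule exI[of _ "prod_encode (i, k)"]) (simp add: le_prod_encode_2)

section \<open>The maximality principle\<close>

theorem theorem6:
  fixes X :: "'a set"
    and D :: "nat \<Rightarrow> 'a \<Rightarrow> 'a \<Rightarrow> real"
    and \<Phi> :: "nat \<Rightarrow> 'a \<Rightarrow> real"
  assumes "X \<noteq> {}"
    and "\<And>i. semimetric_on X (D i)"
    and "sufficient_family X D"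
    and "D_complete X D"
    and "(\<forall>i. class_P3 X (\<Phi> i)) \<or> (\<forall>i. class_P4 X (\<Phi> i))"
    and "(\<forall>i. class_L2 X D (\<Phi> i)) \<or> (\<forall>i. class_L3 X D (\<Phi> i))"
  shows "\<forall>u\<in>X. \<exists>v\<in>X.
           (\<forall>i. D i u v \<le> \<Phi> i u - \<Phi> i v) \<and>
           (\<forall>x\<in>X - {v}. \<exists>i. D i v x > \<Phi> i v - \<Phi> i x)"
proof
  fix u assume u: "u \<in> X"
  interpret semimetric_family X D
    using assms(2) by unfold_locales
  have "class_P3 X (\<Phi> i)" for i
    using assms(5) class_P4_imp_class_P3[of X "\<Phi> i"] by blast
  then have bdd: "bdd_below (\<Phi> i ` X)" for i
    by (rule class_P3_imp_bdd_below)
  have lsc: "class_L2 X D (\<Phi> i)" for i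
    using assms(6) class_L3_imp_class_L2[of X D "\<Phi> i"] by blast
  define \<iota> where "\<iota> n = fst (prod_decode n)" for n
  obtain s where X: "\<And>n. s n \<in> X" and us: "\<And>n. family_le D \<Phi> u (s n)"
    and asc: "\<And>m n. m \<le> n \<Longrightarrow> family_le D \<Phi> (s m) (s n)"
    and min: "\<And>n x. x \<in> X \<Longrightarrow> family_le D \<Phi> (s n) x \<Longrightarrow>
       \<Phi> (\<iota> n) (s (Suc n)) \<le> \<Phi> (\<iota> n) x + 1 / real (Suc n)"
    by (rule ex_minimizing_ascending[where \<iota> = \<iota> and \<Phi> = \<Phi>, OF u bdd])
      (rule that; assumption)
  obtain v where conv: "D_converges X D s v"
    using ascending_imp_D_Cauchy[where s = s and \<Phi> = \<Phi>, OF X asc bdd] assms(4)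
    by (auto simp: D_complete_def)
  then have v: "v \<in> X" by (simp add: D_converges_def)
  have sv: "family_le D \<Phi> (s n) v" for n
    using asc conv lsc by (rule ascending_limit_upper_bound)
  have maximal: "x = v" if x: "x \<in> X" and vx: "family_le D \<Phi> v x" for x
  proof -
    have sx: "family_le D \<Phi> (s n) x" for n
      using X v x sv vx by (rule family_le_trans)
    have "D i v x = 0" for i
    proof -
      have "\<Phi> i v \<le> \<Phi> i x + e" if "0 < e" for e
      proof -
        obtain k where k: "1 / real (Suc k) < e"
          using \<open>0 < e\<close> nat_approx_posE by blast
        obtain n where n: "n \<ge> k" "\<iota> n = i"
          using schedule_infinitely_often unfolding \<iota>_def by blast
        have "\<Phi> i v \<le> \<Phi> i (s (Suc n))"
          using X v sv by (rule family_le_antimono)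
        also have "\<dots> \<le> \<Phi> i x + 1 / real (Suc n)"
          using min[OF x sx, of n] n(2) by simp
        also have "\<dots> \<le> \<Phi> i x + 1 / real (Suc k)"
          using n(1) by (simp add: frac_le)
        finally show ?thesis using k by linarith
      qed
      then have "\<Phi> i v \<le> \<Phi> i x" by (rule field_le_epsilon)
      then show ?thesis
        using family_leD[OF vx, of i] dist_nonneg[OF v x, of i] by linarith
    qed
    then show ?thesis
      using assms(3) v x unfolding sufficient_family_def by blast
  qed
  have "family_le D \<Phi> u v"
    using u X v us sv by (rule family_le_trans)
  moreover have "\<exists>i. D i v x > \<Phi> i v - \<Phi> i x" if "x \<in> X - {v}" for x
    using maximal[of x] that unfolding family_le_def by (metis DiffE not_le singletonI)
  ultimately show "\<exists>v\<in>X. (\<forall>i. D i u v \<le> \<Phi> i u - \<Phi> i v) \<and>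
           (\<forall>x\<in>X - {v}. \<exists>i. D i v x > \<Phi> i v - \<Phi> i x)"
    using v unfolding family_le_def by blast
qed

end
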